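(* There is a constant $C>0$, depending only on the universal constant $C_0$ of the subroutine QuantEst, such that the following holds. Let $\nu\in\mathcal E$ and run Algorithm 1 on $\nu$ with input $(\mathcal A,\lambda,\epsilon,q,\delta)$ and parameter $c\ge 1$. Then on the event $E$ the total number of arm pulls is at most $$C\sum_{k\in\mathcal A}\frac{1}{\max(\Delta_k,\Delta)^2}\left(\log\frac1\delta+\log\frac{1}{\max(\Delta_k,\Delta)}+\log\frac{c\lambda K}{\epsilon}\right),$$ where $\Delta_k=\Delta_k(\nu,\lambda,\epsilon,c,q)$ are the arm gaps and $\Delta=\max_{a\in\mathcal A_\epsilon(\nu)}\Delta_a$ (the bound is read as $+\infty$ if $\max(\Delta_k,\Delta)=0$ for some $k$).
   Context: Setting. Arms $\mathcal A=\{1,\dots,K\}$ with $K\ge2$, level $q\in(0,1)$, $\lambda>\epsilon>0$, $\delta\in(0,1)$, integer $c\ge1$. An instance is a tuple $\nu=(F_1,\dots,F_K)$ of CDFs on $\mathbb R$; each pull of arm $k$ yields an independent reward with CDF $F_k$. For real $p$ put $Q_k(p)=\sup\{x\in\mathbb R:F_k(x)<p\}$ and $Q_k^+(p)=\sup\{x\in\mathbb R:F_k(x)\le p\}$, with values in $[-\infty,\infty]$ ($\sup\varnothing=-\infty$ here). $\mathcal E$ is the set of instances with $Q_k(q)\in[0,\lambda]$ for every $k$. $\mathcal A_\epsilon(\nu)=\{k: Q_k(q)\ge\max_{a}Q_a(q)-\epsilon\}$. QuantEst. Feedback is 1-bit: for each pull of arm $k$ the learner chooses a threshold $\gamma$ and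 observes only $\mathbf 1\{r\le\gamma\}$ for a fresh reward $r\sim F_k$. $\mathrm{QuantEst}(F,\mathbf x,\tau,D,\delta')$ is a subroutine which, given 1-bit threshold-query access to an arm with CDF $F$, a non-decreasing list $\mathbf x$ of $N$ points, $\tau\in(0,1)$, $0<D\le\min(\tau,1-\tau)$ and $\delta'\in(0,1)$, uses at most $C_0D^{-2}\log(N/\delta')$ fresh arm pulls ($C_0$ universal) and outputs an index $i$ such that, with probability at least $1-\delta'$ (conditionally on the past), $[F(x_i),F(x_{i+1})]\cap(\tau-D,\tau+D)\ne\varnothing$. Algorithm 1. Set $n=\lceil(c+1)\lambda/\epsilon\rceil$, $\tilde\epsilon=\lambda/n$, $\mathbf x=[x_0,\dots,x_{n+2}]$ with $x_0=-\infty$, $x_i=(i-1)\tilde\epsilon$ for $1\le i\le n+1$, $x_{n+2}=+\infty$ ($F_k(-\infty)=0$, $F_k(+\infty)=1$). Set $\mathcal A_1=\mathcal A$, $\mathrm{LCB}_0(k)=0$, $\mathrm{UCB}_0(k)=\lambda$. For $t=1,2,\dots$: if some $k\in\mathcal A_t$ satisfies $\mathrm{LCB}_{t-1}(k)\ge\max_{a\in\mathcal A_t\setminus\{k\}}\mathrm{UCB}_{t-1}(a)-(c+1)\tilde\epsilon$, stop and return any such arm. Otherwise perform round $t$: put $\Delta^{(t)}=2^{-t+1}\min(q,1-q)$; for each $k\in\mathcal A_t$ let $l_{t,k}\in\{0,\dots,n+1\}$ be the output of $\mathrm{QuantEst}\big(F_k,\mathbf x,q-\tfrac{\Delta^{(t)}}2,\tfrac{\Delta^{(t)}}2,\tfrac{\delta\Delta^{(t)}}{2|\mathcal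 A_t|}\big)$ and $u_{t,k}\in\{0,\dots,n+1\}$ that of $\mathrm{QuantEst}\big(F_k,\mathbf x,q+\tfrac{\Delta^{(t)}}2,\tfrac{\Delta^{(t)}}2,\tfrac{\delta\Delta^{(t)}}{2|\mathcal A_t|}\big)$; put $\mathrm{LCB}_t(k)=\max(x_{l_{t,k}},\mathrm{LCB}_{t-1}(k))$ and $\mathrm{UCB}_t(k)=\min(x_{u_{t,k}+1},\mathrm{UCB}_{t-1}(k))$; finally $\mathcal A_{t+1}=\{k\in\mathcal A_t:\mathrm{UCB}_t(k)>\max_{a\in\mathcal A_t}\mathrm{LCB}_t(a)\}$. Event $E$: for every performed round $t$ and every $k\in\mathcal A_t$, both $[F_k(x_{l_{t,k}}),F_k(x_{l_{t,k}+1})]\cap(q-\Delta^{(t)},q)\neq\varnothing$ and $[F_k(x_{u_{t,k}}),F_k(x_{u_{t,k}+1})]\cap(q,q+\Delta^{(t)})\neq\varnothing$. Arm gaps, with $\mathcal A_\epsilon=\mathcal A_\epsilon(\nu)$. For $k\notin\mathcal A_\epsilon$, $\Delta_k=\sup\{\Delta\in[0,\min(q,1-q)]: Q_k(q+\Delta)\le\max_{a\in\mathcal A}Q_a^+(q-\Delta)-\tilde\epsilon\}$. For $k\in\mathcal A_\epsilon$, $\Delta_k=\max_{\mathcal A_\epsilon\subseteq S\subseteq\mathcal A}\Delta_k^{(S)}$, where $\Delta_k^{(S)}=\sup\{\Delta\in[0,\min_{a\notin S}\Delta_a]: Q_k^+(q-\Delta)\ge\max_{a\in S\setminus\{k\}}Q_a(q+\Delta)-c\tilde\epsilon\}$.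 Conventions: the minimum (maximum) of an empty set is $\infty$ ($-\infty$); the supremum of an empty set of values of $\Delta$ is $0$. *)

theory Defs
  imports "HOL-Probability.Probability"
begin

text \<open>
  An instance assigns to each arm \<open>k \<in> {1..K}\<close> a probability distribution \<open>\<nu> k\<close> on the reals;
  its CDF \<open>F\<^sub>k\<close> is \<open>cdf (\<nu> k)\<close>.  Quantiles take values in \<open>ereal\<close>, where the supremum (infimum)
  of the empty set is \<open>-\<infinity>\<close> (\<open>\<infinity>\<close>), so \<open>SUP\<close> and \<open>INF\<close> over finite sets of arms follow the usual
  conventions for empty maxima and minima.
\<close>

definition quantile :: "real measure \<Rightarrow> real \<Rightarrow> ereal" where
  "quantile M p = Sup {ereal x | x. cdf M x < p}"

definition upper_quantile :: "real measure \<Rightarrow> real \<Rightarrow> ereal" where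
  "upper_quantile M p = Sup {ereal x | x. cdf M x \<le> p}"

definition instances :: "nat \<Rightarrow> real \<Rightarrow> real \<Rightarrow> (nat \<Rightarrow> real measure) set" where
  "instances K q lam =
     {\<nu>. \<forall>k\<in>{1..K}. real_distribution (\<nu> k) \<and> quantile (\<nu> k) q \<in> {0..ereal lam}}"

definition eps_optimal :: "nat \<Rightarrow> real \<Rightarrow> real \<Rightarrow> (nat \<Rightarrow> real measure) \<Rightarrow> nat set" where
  "eps_optimal K q eps \<nu> =
     {k\<in>{1..K}. quantile (\<nu> k) q \<ge> (SUP a\<in>{1..K}. quantile (\<nu> a) q) - ereal eps}"

definition grid_size :: "real \<Rightarrow> real \<Rightarrow> nat \<Rightarrow> nat" where
  "grid_size lam eps c = nat \<lceil>(real c + 1) * lam / eps\<rceil>"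

definition grid_step :: "real \<Rightarrow> real \<Rightarrow> nat \<Rightarrow> real" where
  "grid_step lam eps c = lam / real (grid_size lam eps c)"

definition gap_Sup :: "real set \<Rightarrow> real" where
  "gap_Sup D = (if D = {} then 0 else Sup D)"

definition suboptimal_gap ::
    "nat \<Rightarrow> real \<Rightarrow> real \<Rightarrow> real \<Rightarrow> nat \<Rightarrow> (nat \<Rightarrow> real measure) \<Rightarrow> nat \<Rightarrow> real" where
  "suboptimal_gap K q lam eps c \<nu> k =
     gap_Sup {d. 0 \<le> d \<and> d \<le> min q (1 - q) \<and>
       quantile (\<nu> k) (q + d)
         \<le> (SUP a\<in>{1..K}. upper_quantile (\<nu> a) (q - d)) - ereal (grid_step lam eps c)}"

text \<open>
  For \<open>S = {1..K}\<close> the infimum below is \<open>\<infinity>\<close>.  The set of gap values is nevertheless bounded for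
  \<open>K \<ge> 2\<close> and \<open>\<nu> \<in> instances K q lam\<close>: if \<open>d > q\<close> the left-hand quantile is \<open>-\<infinity>\<close>, and if
  \<open>d > 1 - q\<close> the right-hand maximum is \<open>\<infinity>\<close>.
\<close>

definition gap_within ::
    "nat \<Rightarrow> real \<Rightarrow> real \<Rightarrow> real \<Rightarrow> nat \<Rightarrow> (nat \<Rightarrow> real measure) \<Rightarrow> nat set \<Rightarrow> nat \<Rightarrow> real" where
  "gap_within K q lam eps c \<nu> S k =
     gap_Sup {d. 0 \<le> d \<and> ereal d \<le> (INF a\<in>{1..K} - S. ereal (suboptimal_gap K q lam eps c \<nu> a)) \<and>
       upper_quantile (\<nu> k) (q - d)
         \<ge> (SUP a\<in>S - {k}. quantile (\<nu> a) (q + d)) - ereal (real c * grid_step lam eps c)}"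

definition arm_gap ::
    "nat \<Rightarrow> real \<Rightarrow> real \<Rightarrow> real \<Rightarrow> nat \<Rightarrow> (nat \<Rightarrow> real measure) \<Rightarrow> nat \<Rightarrow> real" where
  "arm_gap K q lam eps c \<nu> k =
     (if k \<in> eps_optimal K q eps \<nu>
      then Max {gap_within K q lam eps c \<nu> S k | S. eps_optimal K q eps \<nu> \<subseteq> S \<and> S \<subseteq> {1..K}}
      else suboptimal_gap K q lam eps c \<nu> k)"

text \<open>
  An adaptive procedure with one-bit feedback is a decision tree.  At a node \<open>Query \<gamma> f\<close> the arm is
  pulled once and the procedure continues with \<open>f b\<close>, where \<open>b\<close> is the bit \<open>r \<le> \<gamma>\<close> for the fresh
  reward \<open>r\<close>; a leaf carries the output.  A tree is run on a sequence of rewards of the arm.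
\<close>

datatype query_tree = Output nat | Query ereal "bool \<Rightarrow> query_tree"

primrec tree_output :: "query_tree \<Rightarrow> (nat \<Rightarrow> real) \<Rightarrow> nat" where
  "tree_output (Output i) r = i"
| "tree_output (Query \<gamma> f) r = tree_output (f (ereal (r 0) \<le> \<gamma>)) (\<lambda>j. r (Suc j))"

primrec tree_pulls :: "query_tree \<Rightarrow> (nat \<Rightarrow> real) \<Rightarrow> nat" where
  "tree_pulls (Output i) r = 0"
| "tree_pulls (Query \<gamma> f) r = Suc (tree_pulls (f (ereal (r 0) \<le> \<gamma>)) (\<lambda>j. r (Suc j)))"

text \<open>
  A QuantEst procedure receives a random seed (uniform on \<open>[0, 1]\<close>, for internal randomisation), the
  list of points, \<open>\<tau>\<close>, \<open>D\<close> and \<open>\<delta>'\<close>.  It accesses the arm only through the queries in its tree.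
\<close>

type_synonym quant_est = "real \<Rightarrow> ereal list \<Rightarrow> real \<Rightarrow> real \<Rightarrow> real \<Rightarrow> query_tree"

fun cdf_ext :: "real measure \<Rightarrow> ereal \<Rightarrow> real" where
  "cdf_ext M (ereal x) = cdf M x"
| "cdf_ext M PInfty = 1"
| "cdf_ext M MInfty = 0"

definition hits :: "real measure \<Rightarrow> ereal list \<Rightarrow> nat \<Rightarrow> real \<Rightarrow> real \<Rightarrow> bool" where
  "hits M xs i a b \<longleftrightarrow> {cdf_ext M (xs ! i) .. cdf_ext M (xs ! Suc i)} \<inter> {a<..<b} \<noteq> {}"

definition seed_measure :: "real measure" where
  "seed_measure = uniform_measure lborel {0..1}"

text \<open>
  Correctness with probability at least \<open>1 - \<delta>'\<close> is required for every arm for which a correct index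
  exists at all (always the case if the list starts with \<open>-\<infinity>\<close> and ends with \<open>\<infinity>\<close>).  As every call
  is run on fresh rewards and a fresh seed, this is the guarantee conditionally on the past.
\<close>

definition quant_est_spec :: "real \<Rightarrow> quant_est \<Rightarrow> bool" where
  "quant_est_spec C0 QE \<longleftrightarrow>
     (\<forall>xs \<tau> D \<delta>'. sorted xs \<and> 2 \<le> length xs \<and> 0 < \<tau> \<and> \<tau> < 1 \<and> 0 < D \<and> D \<le> min \<tau> (1 - \<tau>) \<and>
        0 < \<delta>' \<and> \<delta>' < 1 \<longrightarrow>
        (\<forall>s r. real (tree_pulls (QE s xs \<tau> D \<delta>') r) \<le> C0 / D\<^sup>2 * ln (real (length xs) / \<delta>') \<and>
               Suc (tree_output (QE s xs \<tau> D \<delta>') r) < length xs) \<and>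
        (\<forall>M. real_distribution M \<and> (\<exists>i. Suc i < length xs \<and> hits M xs i (\<tau> - D) (\<tau> + D)) \<longrightarrow>
           measure (seed_measure \<Otimes>\<^sub>M PiM (UNIV :: nat set) (\<lambda>_. M))
             {(s, r). hits M xs (tree_output (QE s xs \<tau> D \<delta>') r) (\<tau> - D) (\<tau> + D)} \<ge> 1 - \<delta>'))"

text \<open>
  A sample point consists of the rewards and the seeds: \<open>fst \<omega> (k, j)\<close> is the reward of the pull
  number \<open>j\<close> (counted from 0) of arm \<open>k\<close>, and \<open>snd \<omega> (t, k, b)\<close> is the seed of the QuantEst call for
  arm \<open>k\<close> in round \<open>t\<close> that determines \<open>u\<^sub>t\<^sub>,\<^sub>k\<close> if \<open>b\<close> is true and \<open>l\<^sub>t\<^sub>,\<^sub>k\<close> otherwise.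
\<close>

type_synonym sample = "(nat \<times> nat \<Rightarrow> real) \<times> (nat \<times> nat \<times> bool \<Rightarrow> real)"

definition sample_measure :: "nat \<Rightarrow> (nat \<Rightarrow> real measure) \<Rightarrow> sample measure" where
  "sample_measure K \<nu> =
     PiM ({1..K} \<times> UNIV) (\<lambda>(k, j). \<nu> k) \<Otimes>\<^sub>M PiM UNIV (\<lambda>_. seed_measure)"

definition grid :: "real \<Rightarrow> real \<Rightarrow> nat \<Rightarrow> ereal list" where
  "grid lam eps c =
     [-\<infinity>] @ map (\<lambda>i. ereal (real i * grid_step lam eps c)) [0..<Suc (grid_size lam eps c)] @ [\<infinity>]"

record alg_state =
  active :: "nat set"
  lcb :: "nat \<Rightarrow> ereal"
  ucb :: "nat \<Rightarrow> ereal"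
  pulls :: "nat \<Rightarrow> nat"

locale algorithm1 =
  fixes QE :: quant_est
    and K :: nat
    and lam eps q \<delta> :: real
    and c :: nat
begin

definition xs :: "ereal list" where
  "xs = grid lam eps c"

definition radius :: "nat \<Rightarrow> real" where
  "radius t = 2 powi (1 - int t) * min q (1 - q)"

definition rewards_from :: "sample \<Rightarrow> nat \<Rightarrow> nat \<Rightarrow> nat \<Rightarrow> real" where
  "rewards_from \<omega> k m = (\<lambda>j. fst \<omega> (k, m + j))"

definition call_tree :: "sample \<Rightarrow> nat \<Rightarrow> alg_state \<Rightarrow> nat \<Rightarrow> bool \<Rightarrow> query_tree" where
  "call_tree \<omega> t s k b =
     QE (snd \<omega> (t, k, b)) xs
        (if b then q + radius t / 2 else q - radius t / 2) (radius t / 2)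
        (\<delta> * radius t / (2 * real (card (active s))))"

definition l_index :: "sample \<Rightarrow> nat \<Rightarrow> alg_state \<Rightarrow> nat \<Rightarrow> nat" where
  "l_index \<omega> t s k = tree_output (call_tree \<omega> t s k False) (rewards_from \<omega> k (pulls s k))"

definition l_pulls :: "sample \<Rightarrow> nat \<Rightarrow> alg_state \<Rightarrow> nat \<Rightarrow> nat" where
  "l_pulls \<omega> t s k = tree_pulls (call_tree \<omega> t s k False) (rewards_from \<omega> k (pulls s k))"

definition u_index :: "sample \<Rightarrow> nat \<Rightarrow> alg_state \<Rightarrow> nat \<Rightarrow> nat" where
  "u_index \<omega> t s k =
     tree_output (call_tree \<omega> t s k True) (rewards_from \<omega> k (pulls s k + l_pulls \<omega> t s k))"

definition u_pulls :: "sample \<Rightarrow> nat \<Rightarrow> alg_state \<Rightarrow> nat \<Rightarrow> nat" where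
  "u_pulls \<omega> t s k =
     tree_pulls (call_tree \<omega> t s k True) (rewards_from \<omega> k (pulls s k + l_pulls \<omega> t s k))"

definition stopping :: "alg_state \<Rightarrow> bool" where
  "stopping s \<longleftrightarrow>
     (\<exists>k\<in>active s. lcb s k \<ge> (SUP a\<in>active s - {k}. ucb s a)
                                - ereal ((real c + 1) * grid_step lam eps c))"

definition perform_round :: "sample \<Rightarrow> nat \<Rightarrow> alg_state \<Rightarrow> alg_state" where
  "perform_round \<omega> t s =
     (let L = (\<lambda>k. if k \<in> active s then max (xs ! l_index \<omega> t s k) (lcb s k) else lcb s k);
          U = (\<lambda>k. if k \<in> active s then min (xs ! Suc (u_index \<omega> t s k)) (ucb s k) else ucb s k)
      in \<lparr> active = {k\<in>active s. U k > (SUP a\<in>active s. L a)},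
           lcb = L,
           ucb = U,
           pulls = (\<lambda>k. if k \<in> active s then pulls s k + l_pulls \<omega> t s k + u_pulls \<omega> t s k
                        else pulls s k) \<rparr>)"

text \<open>
  \<open>state \<omega> t\<close> is the state after \<open>t\<close> rounds (unchanged once the algorithm has stopped), so round
  \<open>Suc t\<close> is performed iff \<open>\<not> stopping (state \<omega> t)\<close>.
\<close>

primrec state :: "sample \<Rightarrow> nat \<Rightarrow> alg_state" where
  "state \<omega> 0 = \<lparr> active = {1..K}, lcb = (\<lambda>_. 0), ucb = (\<lambda>_. ereal lam), pulls = (\<lambda>_. 0) \<rparr>"
| "state \<omega> (Suc t) =
     (if stopping (state \<omega> t) then state \<omega> t else perform_round \<omega> (Suc t) (state \<omega> t))"

definition total_pulls :: "sample \<Rightarrow> ereal" where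
  "total_pulls \<omega> = (SUP t. ereal (real (\<Sum>k\<in>{1..K}. pulls (state \<omega> t) k)))"

definition good_event :: "(nat \<Rightarrow> real measure) \<Rightarrow> sample set" where
  "good_event \<nu> =
     {\<omega> \<in> space (sample_measure K \<nu>).
        \<forall>t. \<not> stopping (state \<omega> t) \<longrightarrow>
          (\<forall>k\<in>active (state \<omega> t).
             hits (\<nu> k) xs (l_index \<omega> (Suc t) (state \<omega> t) k) (q - radius (Suc t)) q \<and>
             hits (\<nu> k) xs (u_index \<omega> (Suc t) (state \<omega> t) k) q (q + radius (Suc t)))}"

end

end

theory Submission
  imports Defs
begin

text \<open>
  On the good event, a round of radius \<open>d\<close> gives \<open>UCB k < Q\<^sub>k (q + d) + g\<close> (or \<open>UCB k \<le> 0\<close>) and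
  \<open>Q\<^sub>k\<^sup>+ (q - d) \<le> LCB k + g\<close>, where \<open>g\<close> is the grid step.  As the bounds lie on the grid and one
  of the inequalities is strict, a total loss of \<open>2 g\<close> costs only a single grid step.  Hence a
  suboptimal arm of gap above \<open>d\<close> is eliminated, and the algorithm stops (or no active arm is left)
  once some \<open>\<epsilon>\<close>-optimal arm has gap above \<open>d\<close>; if that arm has been eliminated, an active arm
  whose lower bound is at least its quantile takes over its role.  So arm \<open>k\<close> is pulled only in
  rounds of radius at least \<open>max \<Delta>\<^sub>k \<Delta> / 2\<close>, and the costs of these rounds form a geometric series.
\<close>

section \<open>Quantiles\<close>

lemma quantile_mono:
  assumes "p \<le> p'"
  shows "quantile M p \<le> quantile M p'"
  unfolding quantile_def using assms by (intro Sup_subset_mono) auto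

lemma upper_quantile_mono:
  assumes "p \<le> p'"
  shows "upper_quantile M p \<le> upper_quantile M p'"
  unfolding upper_quantile_def using assms by (intro Sup_subset_mono) auto

lemma upper_quantile_le_quantile:
  assumes "p < p'"
  shows "upper_quantile M p \<le> quantile M p'"
  unfolding upper_quantile_def quantile_def using assms by (intro Sup_subset_mono) auto

text \<open>Right continuity keeps the CDF below \<open>p\<close> slightly to the right of
  \<open>x\<close>, so the supremum lies beyond \<open>x\<close>. This strictness later saves one
  grid step.\<close>

lemma less_quantile:
  assumes "real_distribution M" "cdf M x < p"
  shows "ereal x < quantile M p"
proof -
  interpret real_distribution M by fact
  have "(cdf M \<longlongrightarrow> cdf M x) (at_right x)"
    using cdf_is_right_cont[of x] by (simp add: continuous_within)
  then have "eventually (\<lambda>y. cdf M y < p) (at_right x)"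
    using assms(2) by (rule order_tendstoD)
  then obtain b where "b > x" "\<And>y. x < y \<Longrightarrow> y < b \<Longrightarrow> cdf M y < p"
    unfolding eventually_at_right_field by auto
  then obtain y where "x < y" "cdf M y < p"
    using dense[of x b] by auto
  then have "ereal y \<le> quantile M p"
    unfolding quantile_def by (intro Sup_upper) auto
  then show ?thesis
    using \<open>x < y\<close> by (meson less_ereal.simps(1) order_less_le_trans)
qed

lemma upper_quantile_le:
  assumes "real_distribution M" "p < cdf M x"
  shows "upper_quantile M p \<le> ereal x"
proof -
  interpret real_distribution M by fact
  have "y \<le> x" if "cdf M y \<le> p" for y
    using that assms(2) cdf_nondecreasing[of x y] by linarith
  then show ?thesis
    unfolding upper_quantile_def by (intro Sup_least) auto
qed

lemma quantile_le:
  assumes "real_distribution M" "p \<le> cdf M x"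
  shows "quantile M p \<le> ereal x"
proof -
  interpret real_distribution M by fact
  have "y \<le> x" if "cdf M y < p" for y
    using that assms(2) cdf_nondecreasing[of x y] by linarith
  then show ?thesis
    unfolding quantile_def by (intro Sup_least) auto
qed

lemma upper_quantile_neg:
  assumes "real_distribution M" "p < 0"
  shows "upper_quantile M p = -\<infinity>"
proof -
  interpret real_distribution M by fact
  have "{ereal x | x. cdf M x \<le> p} = {}"
    using assms(2) order_less_le_trans[OF assms(2) cdf_nonneg] by (auto simp: not_le)
  then show ?thesis
    unfolding upper_quantile_def by (simp add: bot_ereal_def)
qed

lemma quantile_gt_1:
  assumes "real_distribution M" "1 < p"
  shows "quantile M p = \<infinity>"
proof -
  interpret real_distribution M by fact
  have "ereal x \<le> quantile M p" for x
    unfolding quantile_def using cdf_bounded_prob[of x] assms(2)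
    by (intro Sup_upper) force
  then show ?thesis
    by (rule ereal_top)
qed

lemma finite_SUP_attained:
  fixes f :: "'a \<Rightarrow> 'b::complete_linorder"
  assumes "finite A" "A \<noteq> {}"
  obtains a where "a \<in> A" "(SUP a\<in>A. f a) = f a"
proof -
  have "(SUP a\<in>A. f a) = Max (f ` A)"
    using assms by (intro cSup_eq_Max) auto
  moreover have "Max (f ` A) \<in> f ` A"
    using assms by (intro Max_in) auto
  ultimately show ?thesis
    using that by auto
qed

section \<open>Arm gaps\<close>

text \<open>With \<open>0 \<le> d\<close> the empty set, whose default value is 0, cannot occur, so
  \<open>d\<close> lies below a genuine supremum.\<close>

lemma less_gap_SupD:
  assumes "d < gap_Sup D" "0 \<le> d"
  shows "\<exists>d'\<in>D. d < d'"
  using assms less_cSupD[of D d] by (auto simp: gap_Sup_def split: if_splits)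

lemma gap_Sup_bounds:
  assumes "\<And>d. d \<in> D \<Longrightarrow> 0 \<le> d \<and> d \<le> b" "0 \<le> b"
  shows "gap_Sup D \<in> {0..b}"
proof (cases "D = {}")
  case True
  then show ?thesis using assms(2) by (simp add: gap_Sup_def)
next
  case False
  then obtain d where "d \<in> D" by blast
  moreover have "bdd_above D" using assms(1) by (intro bdd_aboveI[of _ b]) auto
  ultimately have "0 \<le> Sup D" using assms(1) by (meson cSup_upper order_trans)
  then show ?thesis
    using False assms(1) by (auto simp: gap_Sup_def intro: cSup_least)
qed

lemma suboptimal_gap_bounds:
  assumes "0 < q" "q < 1"
  shows "suboptimal_gap K q lam eps c \<nu> k \<in> {0..min q (1 - q)}"
  unfolding suboptimal_gap_def using assms by (intro gap_Sup_bounds) auto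

text \<open>Some feasible \<open>d'\<close> lies strictly above \<open>d\<close>, so it does not
  matter whether the supremum is attained. Lowering \<open>d'\<close> to \<open>d\<close> decreases
  the left quantile and increases the right one, and the maximum over the finitely many arms is
  attained by a single arm.\<close>

lemma less_suboptimal_gapD:
  assumes "d < suboptimal_gap K q lam eps c \<nu> k" "0 \<le> d" "K \<ge> 1"
  shows "\<exists>a\<in>{1..K}. quantile (\<nu> k) (q + d) + ereal (grid_step lam eps c)
                    \<le> upper_quantile (\<nu> a) (q - d)"
proof -
  let ?g = "ereal (grid_step lam eps c)"
  obtain d' where d': "d < d'"
    "quantile (\<nu> k) (q + d') \<le> (SUP a\<in>{1..K}. upper_quantile (\<nu> a) (q - d')) - ?g"
    using less_gap_SupD[OF assms(1)[unfolded suboptimal_gap_def] assms(2)] by auto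
  obtain a where a: "a \<in> {1..K}"
    "(SUP a\<in>{1..K}. upper_quantile (\<nu> a) (q - d')) = upper_quantile (\<nu> a) (q - d')"
    using finite_SUP_attained[of "{1..K}" "\<lambda>a. upper_quantile (\<nu> a) (q - d')"] assms(3) by auto
  have "quantile (\<nu> k) (q + d) \<le> quantile (\<nu> k) (q + d')"
    using d'(1) by (intro quantile_mono) auto
  also have "\<dots> \<le> upper_quantile (\<nu> a) (q - d') - ?g"
    using d'(2) a(2) by simp
  finally have "quantile (\<nu> k) (q + d) + ?g \<le> upper_quantile (\<nu> a) (q - d')"
    by (simp add: ereal_le_minus)
  also have "\<dots> \<le> upper_quantile (\<nu> a) (q - d)"
    using d'(1) by (intro upper_quantile_mono) auto
  finally show ?thesis
    using a(1) by blast
qed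

text \<open>Both constraints pass from a feasible \<open>d' > d\<close> down to \<open>d\<close> by
  monotonicity. At radius \<open>d\<close> the first fact disposes of the arms outside
  \<open>S\<close>, and the second compares \<open>k\<close> with its rivals inside
  \<open>S\<close>.\<close>

lemma less_gap_withinD:
  assumes "d < gap_within K q lam eps c \<nu> S k" "0 \<le> d"
  shows "\<And>a. a \<in> {1..K} - S \<Longrightarrow> d < suboptimal_gap K q lam eps c \<nu> a"
    and "\<And>a. a \<in> S - {k} \<Longrightarrow> quantile (\<nu> a) (q + d)
           \<le> upper_quantile (\<nu> k) (q - d) + ereal (real c * grid_step lam eps c)"
proof -
  let ?cg = "ereal (real c * grid_step lam eps c)"
  obtain d' where d': "d < d'"
    "ereal d' \<le> (INF a\<in>{1..K} - S. ereal (suboptimal_gap K q lam eps c \<nu> a))"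
    "(SUP a\<in>S - {k}. quantile (\<nu> a) (q + d')) - ?cg \<le> upper_quantile (\<nu> k) (q - d')"
    using less_gap_SupD[OF assms(1)[unfolded gap_within_def] assms(2)] by auto
  show "d < suboptimal_gap K q lam eps c \<nu> a" if "a \<in> {1..K} - S" for a
    using d'(1,2) INF_lower[OF that, of "\<lambda>a. ereal (suboptimal_gap K q lam eps c \<nu> a)"]
    by (meson ereal_less_eq(3) less_le_trans order_trans)
  show "quantile (\<nu> a) (q + d) \<le> upper_quantile (\<nu> k) (q - d) + ?cg" if "a \<in> S - {k}" for a
  proof -
    have "quantile (\<nu> a) (q + d) \<le> quantile (\<nu> a) (q + d')"
      using d'(1) by (intro quantile_mono) auto
    also have "\<dots> \<le> (SUP a\<in>S - {k}. quantile (\<nu> a) (q + d'))"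
      using that by (rule SUP_upper)
    also have "\<dots> \<le> upper_quantile (\<nu> k) (q - d') + ?cg"
      using d'(3) by (simp add: ereal_minus_le)
    also have "\<dots> \<le> upper_quantile (\<nu> k) (q - d) + ?cg"
      using d'(1) by (intro add_right_mono upper_quantile_mono) auto
    finally show ?thesis .
  qed
qed

text \<open>If \<open>S\<close> misses an arm, the gap of that arm caps \<open>d\<close>. If
  \<open>S\<close> contains all arms, compare \<open>k\<close> with another arm \<open>a\<close>:
  for \<open>d > q\<close> the upper quantile of \<open>k\<close> is -infinity while that of
  \<open>a\<close> is bounded below by 0, and for \<open>d > 1 - q\<close> the quantile of
  \<open>a\<close> is infinite while that of \<open>k\<close> stays at most
  \<open>lam\<close>.\<close>

lemma gap_within_bounds:
  assumes "0 < q" "q < 1" "\<nu> \<in> instances K q lam" "2 \<le> K" "k \<in> {1..K}" "S \<subseteq> {1..K}"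
  shows "gap_within K q lam eps c \<nu> S k \<in> {0..min q (1 - q)}"
  unfolding gap_within_def
proof (intro gap_Sup_bounds)
  show "0 \<le> min q (1 - q)" using assms by auto
next
  fix d
  let ?cg = "ereal (real c * grid_step lam eps c)"
  assume "d \<in> {d. 0 \<le> d \<and> ereal d \<le> (INF a\<in>{1..K} - S. ereal (suboptimal_gap K q lam eps c \<nu> a)) \<and>
       upper_quantile (\<nu> k) (q - d) \<ge> (SUP a\<in>S - {k}. quantile (\<nu> a) (q + d)) - ?cg}"
  then have d: "0 \<le> d" "ereal d \<le> (INF a\<in>{1..K} - S. ereal (suboptimal_gap K q lam eps c \<nu> a))"
    "(SUP a\<in>S - {k}. quantile (\<nu> a) (q + d)) - ?cg \<le> upper_quantile (\<nu> k) (q - d)"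
    by auto
  have inst: "real_distribution (\<nu> a)" "0 \<le> quantile (\<nu> a) q" "quantile (\<nu> a) q \<le> ereal lam"
    if "a \<in> {1..K}" for a
    using assms(3) that unfolding instances_def by auto
  have "d \<le> min q (1 - q)"
  proof (cases "{1..K} - S = {}")
    case False
    then obtain a where a: "a \<in> {1..K} - S" by blast
    have "ereal d \<le> ereal (suboptimal_gap K q lam eps c \<nu> a)"
      using d(2) INF_lower[OF a, of "\<lambda>a. ereal (suboptimal_gap K q lam eps c \<nu> a)"]
      by (rule order_trans)
    then show ?thesis
      using suboptimal_gap_bounds[of q K lam eps c \<nu> a] assms(1,2) by simp
  next
    case True
    \<comment> \<open>Any arm other than \<open>k\<close> will do; it exists since
      \<open>2 \<le> K\<close>.\<close>
    define a where "a = (if k = 1 then 2 else 1 :: nat)"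
    have a: "a \<in> S - {k}" "a \<in> {1..K}"
      using True assms(4-6) by (auto simp: a_def)
    have le: "quantile (\<nu> a) (q + d) \<le> upper_quantile (\<nu> k) (q - d) + ?cg"
      using d(3) SUP_upper[OF a(1), of "\<lambda>a. quantile (\<nu> a) (q + d)"]
      by (simp add: ereal_minus_le)
    have "d \<le> q"
    proof (rule ccontr)
      assume "\<not> d \<le> q"
      then have "upper_quantile (\<nu> k) (q - d) = -\<infinity>"
        using inst(1)[OF assms(5)] by (intro upper_quantile_neg) auto
      moreover have "0 \<le> quantile (\<nu> a) (q + d)"
        using inst(2)[OF a(2)] quantile_mono[of q "q + d" "\<nu> a"] d(1) by auto
      ultimately show False using le by simp
    qed
    moreover have "d \<le> 1 - q"
    proof (rule ccontr)
      assume "\<not> d \<le> 1 - q"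
      then have "quantile (\<nu> a) (q + d) = \<infinity>" and "0 < d"
        using inst(1)[OF a(2)] assms(1,2) by (auto intro!: quantile_gt_1)
      moreover have "upper_quantile (\<nu> k) (q - d) \<le> ereal lam"
        using upper_quantile_le_quantile[of "q - d" q "\<nu> k"] inst(3)[OF assms(5)] \<open>0 < d\<close> by auto
      ultimately show False using le by (cases "upper_quantile (\<nu> k) (q - d)") auto
    qed
    ultimately show ?thesis by simp
  qed
  with d(1) show "0 \<le> d \<and> d \<le> min q (1 - q)" by simp
qed

lemma eps_optimal_subset: "eps_optimal K q eps \<nu> \<subseteq> {1..K}"
  by (auto simp: eps_optimal_def)

lemma finite_eps_optimal: "finite (eps_optimal K q eps \<nu>)"
  by (rule finite_subset[OF eps_optimal_subset]) simp

lemma eps_optimal_nonempty: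
  assumes "1 \<le> K" "0 < eps"
  shows "eps_optimal K q eps \<nu> \<noteq> {}"
proof -
  obtain a where a: "a \<in> {1..K}" "(SUP a\<in>{1..K}. quantile (\<nu> a) q) = quantile (\<nu> a) q"
    using finite_SUP_attained[of "{1..K}" "\<lambda>a. quantile (\<nu> a) q"] assms(1) by auto
  have "quantile (\<nu> a) q - ereal eps \<le> quantile (\<nu> a) q"
    using assms(2) by (cases "quantile (\<nu> a) q") auto
  then show ?thesis
    using a by (auto simp: eps_optimal_def)
qed

lemma arm_gap_eps_optimal:
  assumes "k \<in> eps_optimal K q eps \<nu>"
  obtains S where "eps_optimal K q eps \<nu> \<subseteq> S" "S \<subseteq> {1..K}"
    "arm_gap K q lam eps c \<nu> k = gap_within K q lam eps c \<nu> S k"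
proof -
  let ?G = "{gap_within K q lam eps c \<nu> S k | S. eps_optimal K q eps \<nu> \<subseteq> S \<and> S \<subseteq> {1..K}}"
  have "finite ?G"
    by (rule finite_subset[of _ "(\<lambda>S. gap_within K q lam eps c \<nu> S k) ` Pow {1..K}"]) auto
  moreover have "?G \<noteq> {}"
    using eps_optimal_subset[of K q eps \<nu>] by blast
  ultimately have "Max ?G \<in> ?G"
    by (rule Max_in)
  moreover have "arm_gap K q lam eps c \<nu> k = Max ?G"
    using assms by (simp only: arm_gap_def if_True)
  ultimately show ?thesis
    using that by (smt (verit, best) mem_Collect_eq)
qed

lemma arm_gap_bounds:
  assumes "0 < q" "q < 1" "\<nu> \<in> instances K q lam" "2 \<le> K" "k \<in> {1..K}"
  shows "arm_gap K q lam eps c \<nu> k \<in> {0..min q (1 - q)}"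
proof (cases "k \<in> eps_optimal K q eps \<nu>")
  case True
  then obtain S where "S \<subseteq> {1..K}"
    "arm_gap K q lam eps c \<nu> k = gap_within K q lam eps c \<nu> S k"
    by (rule arm_gap_eps_optimal)
  then show ?thesis
    using gap_within_bounds[OF assms] by simp
next
  case False
  then show ?thesis
    using suboptimal_gap_bounds[OF assms(1,2)] by (simp add: arm_gap_def)
qed

lemma Max_arm_gap_attained:
  assumes "1 \<le> K" "0 < eps"
  obtains k where "k \<in> eps_optimal K q eps \<nu>"
    "Max (arm_gap K q lam eps c \<nu> ` eps_optimal K q eps \<nu>) = arm_gap K q lam eps c \<nu> k"
proof -
  have "Max (arm_gap K q lam eps c \<nu> ` eps_optimal K q eps \<nu>)
          \<in> arm_gap K q lam eps c \<nu> ` eps_optimal K q eps \<nu>"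
    using eps_optimal_nonempty[OF assms] finite_eps_optimal by (intro Max_in) auto
  then show ?thesis using that by auto
qed

section \<open>The algorithm on the good event\<close>

lemma hitsD:
  assumes "hits M xs i a b"
  shows "cdf_ext M (xs ! i) < b" "a < cdf_ext M (xs ! Suc i)"
  using assms by (auto simp: hits_def)

text \<open>One sample point of the good event is fixed, so that everything below is a deterministic
  statement about a single run.\<close>

locale algorithm1_run = algorithm1 QE K lam eps q \<delta> c
  for QE :: quant_est and K :: nat and lam eps q \<delta> :: real and c :: nat +
  fixes C0 :: real and \<nu> :: "nat \<Rightarrow> real measure" and \<omega> :: sample
  assumes C0: "0 < C0" and QE: "quant_est_spec C0 QE" and K: "2 \<le> K"
    and q: "0 < q" "q < 1" and eps: "0 < eps" "eps < lam" and \<delta>: "0 < \<delta>" "\<delta> < 1"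
    and c: "1 \<le> c" and \<nu>: "\<nu> \<in> instances K q lam" and \<omega>: "\<omega> \<in> good_event \<nu>"
begin

section \<open>The grid, the radii and a single call of QuantEst\<close>

abbreviation "n \<equiv> grid_size lam eps c"
abbreviation "g \<equiv> grid_step lam eps c"
abbreviation "Q k \<equiv> quantile (\<nu> k)"
abbreviation "Qu k \<equiv> upper_quantile (\<nu> k)"

lemma arm:
  assumes "k \<in> {1..K}"
  shows "real_distribution (\<nu> k)" "0 \<le> Q k q" "Q k q \<le> ereal lam"
  using assms \<nu> unfolding instances_def by auto

lemma n_pos: "0 < n"
  using eps by (simp add: grid_size_def)

lemma n_le: "real n \<le> (real c + 1) * lam / eps + 1"
proof -
  have "0 \<le> (real c + 1) * lam / eps" using eps by simp
  then show ?thesis unfolding grid_size_def by linarith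
qed

lemma g_pos: "0 < g"
  using eps n_pos by (simp add: grid_step_def)

lemma n_g: "real n * g = lam"
  using n_pos by (simp add: grid_step_def)

lemma length_xs: "length xs = n + 3"
  by (simp add: xs_def grid_def)

lemma xs_0: "xs ! 0 = -\<infinity>"
  by (simp add: xs_def grid_def)

lemma xs_Suc: "i \<le> n \<Longrightarrow> xs ! Suc i = ereal (real i * g)"
  by (simp add: xs_def grid_def nth_append del: upt_Suc)

lemma xs_last: "xs ! Suc (Suc n) = \<infinity>"
  by (simp add: xs_def grid_def nth_append)

lemma sorted_xs: "sorted xs"
proof -
  have "sorted (map (\<lambda>i. ereal (real i * g)) [0..<Suc n])"
    using g_pos by (auto simp: sorted_iff_nth_mono simp del: upt_Suc)
  then show ?thesis
    by (auto simp: xs_def grid_def sorted_append simp del: upt_Suc)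
qed

lemma radius_Suc: "radius (Suc t) = min q (1 - q) / 2 ^ t"
  by (simp add: radius_def power_int_minus field_simps)

lemma radius_halved: "radius (Suc t) = radius t / 2"
  by (cases t) (simp_all add: radius_Suc, simp add: radius_def)

lemma radius_pos: "0 < radius t"
  using q by (simp add: radius_def)

lemma radius_Suc_le: "radius (Suc t) \<le> min q (1 - q)"
proof -
  have "min q (1 - q) * 1 \<le> min q (1 - q) * 2 ^ t"
    using q by (intro mult_left_mono) auto
  then show ?thesis by (simp add: radius_Suc divide_le_eq del: min_less_iff_conj min.bounded_iff)
qed

text \<open>A radius of at most \<open>min q (1 - q)\<close> makes level and half-width admissible
  for both kinds of call. The conclusions hold for every seed and every reward sequence, hence also
  along this run.\<close>

lemma quant_est_call:
  assumes "k \<in> active s" "active s \<subseteq> {1..K}"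
  shows "real (tree_pulls (call_tree \<omega> (Suc t) s k b) r)
           \<le> C0 / (radius (Suc t) / 2)\<^sup>2 *
              ln (real (n + 3) / (\<delta> * radius (Suc t) / (2 * real (card (active s)))))"
    and "tree_output (call_tree \<omega> (Suc t) s k b) r \<le> Suc n"
proof -
  let ?D = "radius (Suc t)"
  let ?\<tau> = "if b then q + ?D / 2 else q - ?D / 2"
  let ?\<delta>' = "\<delta> * ?D / (2 * real (card (active s)))"
  have D: "0 < ?D" "?D \<le> q" "?D \<le> 1 - q"
    using radius_pos radius_Suc_le[of t] by auto
  have "finite (active s)"
    using assms(2) finite_subset by blast
  with assms(1) have card: "1 \<le> card (active s)"
    by (auto simp: Suc_le_eq card_gt_0_iff)
  have "\<delta> * ?D < 1 * 1"
    using D q \<delta> by (intro mult_strict_mono) auto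
  then have "?\<delta>' < 1"
    using card by (simp add: divide_less_eq)
  then have "sorted xs \<and> 2 \<le> length xs \<and> 0 < ?\<tau> \<and> ?\<tau> < 1 \<and> 0 < ?D / 2 \<and>
      ?D / 2 \<le> min ?\<tau> (1 - ?\<tau>) \<and> 0 < ?\<delta>' \<and> ?\<delta>' < 1"
    using card D \<delta> q sorted_xs length_xs by auto
  from mp[OF QE[unfolded quant_est_spec_def, THEN spec, THEN spec, THEN spec, THEN spec] this]
  have *: "\<forall>s' r. real (tree_pulls (QE s' xs ?\<tau> (?D / 2) ?\<delta>') r)
          \<le> C0 / (?D / 2)\<^sup>2 * ln (real (length xs) / ?\<delta>') \<and>
        Suc (tree_output (QE s' xs ?\<tau> (?D / 2) ?\<delta>') r) < length xs"
    by (rule conjunct1)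
  show "real (tree_pulls (call_tree \<omega> (Suc t) s k b) r)
           \<le> C0 / (?D / 2)\<^sup>2 * ln (real (n + 3) / ?\<delta>')"
    using *[THEN spec, THEN spec, THEN conjunct1] unfolding call_tree_def length_xs .
  show "tree_output (call_tree \<omega> (Suc t) s k b) r \<le> Suc n"
    using *[THEN spec, THEN spec, THEN conjunct2, of "snd \<omega> (Suc t, k, b)" r]
    unfolding call_tree_def length_xs by simp
qed

section \<open>Grid-valued confidence bounds and their invariant\<close>

definition on_grid :: "ereal \<Rightarrow> bool" where
  "on_grid x \<longleftrightarrow> (\<exists>i\<le>n. x = ereal (real i * g))"

lemma on_gridI: "i \<le> n \<Longrightarrow> on_grid (ereal (real i * g))"
  by (auto simp: on_grid_def)

lemma on_grid_nonneg: "on_grid x \<Longrightarrow> 0 \<le> x"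
  using g_pos by (auto simp: on_grid_def)

lemma on_grid_le:
  assumes "on_grid x"
  shows "x \<le> ereal lam"
proof -
  obtain i where i: "i \<le> n" "x = ereal (real i * g)"
    using assms by (auto simp: on_grid_def)
  have "real i * g \<le> real n * g"
    using i(1) g_pos by (intro mult_right_mono) auto
  then show ?thesis by (simp add: i(2) n_g)
qed

lemma on_grid_max: "on_grid x \<Longrightarrow> on_grid y \<Longrightarrow> on_grid (max x y)"
  by (simp add: max_def)

lemma on_grid_min: "on_grid x \<Longrightarrow> on_grid y \<Longrightarrow> on_grid (min x y)"
  by (simp add: min_def)

text \<open>Grid points are integer multiples of \<open>g\<close>, so a strict bound on their
  distance rounds down to the next whole number of steps.\<close>

lemma on_grid_gap:
  assumes "on_grid x" "on_grid y" "x < y + ereal ((real m + 1) * g)"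
  shows "x \<le> y + ereal (real m * g)"
proof -
  obtain i j where ij: "x = ereal (real i * g)" "y = ereal (real j * g)"
    using assms(1,2) by (auto simp: on_grid_def)
  then have "real i * g < (real j + real m + 1) * g"
    using assms(3) by (simp add: algebra_simps)
  then have "i \<le> j + m"
    using g_pos by simp
  then have "real i * g \<le> real (j + m) * g"
    using g_pos by (intro mult_right_mono) auto
  then show ?thesis
    by (simp add: ij algebra_simps)
qed

text \<open>
  A lower bound that stems from a query is strictly below the quantile, because the CDF is right
  continuous.  Only the initial value 0 can equal it; then the arm with the largest lower bound may
  eliminate itself, and the active set may even become empty.
\<close>

definition inv_state :: "alg_state \<Rightarrow> bool" where
  "inv_state s \<longleftrightarrow> active s \<subseteq> {1..K} \<and>
     (\<forall>k\<in>{1..K}. on_grid (lcb s k) \<and> on_grid (ucb s k) \<and>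
        (lcb s k = 0 \<or> lcb s k < Q k q) \<and> Q k q \<le> ucb s k) \<and>
     (\<forall>k\<in>{1..K} - active s. active s \<noteq> {} \<longrightarrow> (\<exists>b\<in>active s. Q k q \<le> lcb s b))"

lemma inv_stateD:
  assumes "inv_state s"
  shows "active s \<subseteq> {1..K}"
    and "k \<in> {1..K} \<Longrightarrow> on_grid (lcb s k)"
    and "k \<in> {1..K} \<Longrightarrow> on_grid (ucb s k)"
    and "k \<in> {1..K} \<Longrightarrow> lcb s k = 0 \<or> lcb s k < Q k q"
    and "k \<in> {1..K} \<Longrightarrow> Q k q \<le> ucb s k"
    and "k \<in> {1..K} \<Longrightarrow> k \<notin> active s \<Longrightarrow> b \<in> active s \<Longrightarrow> \<exists>b\<in>active s. Q k q \<le> lcb s b"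
  using assms unfolding inv_state_def by blast+

text \<open>A hit gives \<open>F(x_i) < q\<close>, which puts \<open>x_i\<close> strictly below the
  quantile, and \<open>F(x_{i+1}) > q - d\<close>, which puts the upper quantile at most one step
  above \<open>x_i\<close>. Infinite grid ends need separate arguments.\<close>

lemma lcb_update:
  assumes "k \<in> {1..K}" "on_grid L" "L = 0 \<or> L < Q k q" "i \<le> Suc n"
    and "hits (\<nu> k) xs i (q - d) q" "0 < d"
  shows "on_grid (max (xs ! i) L)"
    and "max (xs ! i) L = 0 \<or> max (xs ! i) L < Q k q"
    and "Qu k (q - d) \<le> max (xs ! i) L + ereal g"
proof -
  note hit = hitsD[OF assms(5)]
  have "on_grid (max (xs ! i) L) \<and> (max (xs ! i) L = 0 \<or> max (xs ! i) L < Q k q)"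
  proof (cases i)
    case 0
    then show ?thesis using assms by (simp add: xs_0)
  next
    case (Suc j)
    then have j: "j \<le> n" "xs ! i = ereal (real j * g)"
      using assms(4) xs_Suc by auto
    then have "xs ! i < Q k q"
      using hit(1) less_quantile[OF arm(1)[OF assms(1)]] by simp
    then show ?thesis
      using on_grid_max[OF on_gridI[OF j(1)] assms(2)] j(2) assms(3) by (auto simp: max_def)
  qed
  then show grid: "on_grid (max (xs ! i) L)"
    and "max (xs ! i) L = 0 \<or> max (xs ! i) L < Q k q" by auto
  show "Qu k (q - d) \<le> max (xs ! i) L + ereal g"
  proof (cases "i = Suc n")
    case True
    \<comment> \<open>Here \<open>x_{i+1}\<close> is infinite and gives no bound, but
      \<open>x_i = lam\<close> already bounds the quantile at \<open>q\<close>.\<close>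
    have "Qu k (q - d) \<le> Q k q"
      using assms(6) by (intro upper_quantile_le_quantile) auto
    also have "\<dots> \<le> xs ! i"
      using arm(3)[OF assms(1)] by (simp add: True xs_Suc n_g)
    also have "\<dots> \<le> max (xs ! i) L + ereal g"
      using g_pos by (intro add_increasing2) auto
    finally show ?thesis .
  next
    case False
    then have "xs ! Suc i = ereal (real i * g)"
      using assms(4) by (intro xs_Suc) auto
    then have "Qu k (q - d) \<le> ereal (real i * g)"
      using hit(2) upper_quantile_le[OF arm(1)[OF assms(1)]] by simp
    also have "\<dots> \<le> max (xs ! i) L + ereal g"
    proof (cases i)
      case 0
      \<comment> \<open>Here \<open>x_0\<close> is -infinity and \<open>x_1 = 0\<close>; the old
        bound, being on the grid, is at least 0.\<close>
      then show ?thesis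
        using on_grid_nonneg[OF grid] g_pos by (simp add: zero_ereal_def[symmetric])
    next
      case (Suc j)
      then have "ereal (real i * g) = xs ! i + ereal g"
        using assms(4) by (simp add: xs_Suc algebra_simps)
      then show ?thesis by (simp add: add_right_mono)
    qed
    finally show ?thesis .
  qed
qed

text \<open>A hit gives \<open>F(x_{i+1}) > q\<close>, so the quantile at \<open>q\<close> is at
  most \<open>x_{i+1}\<close>, and \<open>F(x_i) < q + d\<close>, so \<open>x_i\<close> is strictly
  below the quantile at \<open>q + d\<close> and \<open>x_{i+1}\<close> less than one step above
  it.\<close>

lemma ucb_update:
  assumes "k \<in> {1..K}" "on_grid U" "Q k q \<le> U" "i \<le> Suc n"
    and "hits (\<nu> k) xs i q (q + d)" "0 < d"
  shows "on_grid (min (xs ! Suc i) U)"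
    and "Q k q \<le> min (xs ! Suc i) U"
    and "min (xs ! Suc i) U \<le> 0 \<or> min (xs ! Suc i) U < Q k (q + d) + ereal g"
proof -
  note hit = hitsD[OF assms(5)]
  have "on_grid (min (xs ! Suc i) U) \<and> Q k q \<le> min (xs ! Suc i) U"
  proof (cases "i = Suc n")
    case True
    then show ?thesis using assms by (simp add: xs_last)
  next
    case False
    then have i: "i \<le> n" using assms(4) by simp
    then have "Q k q \<le> xs ! Suc i"
      using hit(2) quantile_le[OF arm(1)[OF assms(1)]] by (simp add: xs_Suc)
    then show ?thesis
      using on_grid_min[OF on_gridI[OF i] assms(2)] i assms(3) by (simp add: xs_Suc)
  qed
  then show grid: "on_grid (min (xs ! Suc i) U)" and "Q k q \<le> min (xs ! Suc i) U" by auto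
  show "min (xs ! Suc i) U \<le> 0 \<or> min (xs ! Suc i) U < Q k (q + d) + ereal g"
  proof (cases i)
    case 0
    \<comment> \<open>With \<open>x_0\<close> infinite there is no such comparison;
      \<open>x_1 = 0\<close> accounts for the alternative in the claim.\<close>
    then show ?thesis by (simp add: xs_Suc min_le_iff_disj)
  next
    case (Suc j)
    then have j: "j \<le> n" "xs ! i = ereal (real j * g)"
      using assms(4) xs_Suc by auto
    then have lt: "ereal (real j * g) < Q k (q + d)"
      using hit(1) less_quantile[OF arm(1)[OF assms(1)]] by simp
    have "min (xs ! Suc i) U \<le> ereal (real j * g) + ereal g"
    proof (cases "j = n")
      case True
      \<comment> \<open>Here \<open>x_{i+1}\<close> is infinite, and the old bound, at most
        \<open>lam = x_i\<close>, takes its place.\<close>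
      have "min (xs ! Suc i) U \<le> ereal (real j * g)"
        using on_grid_le[OF grid] by (simp add: True n_g)
      also have "\<dots> \<le> ereal (real j * g) + ereal g"
        using g_pos by simp
      finally show ?thesis .
    next
      case False
      then show ?thesis
        using Suc j(1) by (auto simp: xs_Suc min_le_iff_disj algebra_simps)
    qed
    also have "\<dots> < Q k (q + d) + ereal g"
      using lt by (cases "Q k (q + d)") auto
    finally show ?thesis by simp
  qed
qed

section \<open>One round on the good event\<close>

lemma perform_round_active:
  "active (perform_round \<omega> t s) =
     {k\<in>active s. ucb (perform_round \<omega> t s) k > (SUP a\<in>active s. lcb (perform_round \<omega> t s) a)}"
  by (simp add: perform_round_def Let_def)

lemma round_bounds:
  assumes "inv_state (state \<omega> t)" "\<not> stopping (state \<omega> t)" "k \<in> active (state \<omega> t)"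
  defines "s' \<equiv> state \<omega> (Suc t)" and "d \<equiv> radius (Suc t)"
  shows "on_grid (lcb s' k)" "lcb s' k = 0 \<or> lcb s' k < Q k q"
    "lcb (state \<omega> t) k \<le> lcb s' k" "Qu k (q - d) \<le> lcb s' k + ereal g"
    "on_grid (ucb s' k)" "Q k q \<le> ucb s' k"
    "ucb s' k \<le> 0 \<or> ucb s' k < Q k (q + d) + ereal g"
proof -
  let ?s = "state \<omega> t"
  have k: "k \<in> {1..K}"
    using inv_stateD(1)[OF assms(1)] assms(3) by blast
  have lcb: "lcb s' k = max (xs ! l_index \<omega> (Suc t) ?s k) (lcb ?s k)"
    and ucb: "ucb s' k = min (xs ! Suc (u_index \<omega> (Suc t) ?s k)) (ucb ?s k)"
    using assms(2,3) by (auto simp: s'_def perform_round_def)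
  have hit: "hits (\<nu> k) xs (l_index \<omega> (Suc t) ?s k) (q - d) q"
    "hits (\<nu> k) xs (u_index \<omega> (Suc t) ?s k) q (q + d)"
    using \<omega> assms(2,3) by (auto simp: good_event_def d_def)
  have ind: "l_index \<omega> (Suc t) ?s k \<le> Suc n" "u_index \<omega> (Suc t) ?s k \<le> Suc n"
    unfolding l_index_def u_index_def
    using quant_est_call(2)[OF assms(3) inv_stateD(1)[OF assms(1)]] by auto
  have d: "0 < d" by (simp add: d_def radius_pos)
  note inv = inv_stateD(2-5)[OF assms(1) k]
  show "on_grid (lcb s' k)" "lcb s' k = 0 \<or> lcb s' k < Q k q"
    "Qu k (q - d) \<le> lcb s' k + ereal g"
    unfolding lcb by (rule lcb_update[OF k inv(1,3) ind(1) hit(1) d])+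
  show "on_grid (ucb s' k)" "Q k q \<le> ucb s' k"
    "ucb s' k \<le> 0 \<or> ucb s' k < Q k (q + d) + ereal g"
    unfolding ucb by (rule ucb_update[OF k inv(2,4) ind(2) hit(2) d])+
  show "lcb ?s k \<le> lcb s' k"
    unfolding lcb by simp
qed

text \<open>The clause on eliminated arms is the delicate one. The arm \<open>m\<close> with the
  largest new lower bound dominates every eliminated arm: a newly eliminated one through its upper
  bound, an older one through its previous dominator, whose lower bound has not decreased.\<close>

lemma inv_round:
  assumes inv: "inv_state (state \<omega> t)" and run: "\<not> stopping (state \<omega> t)"
  shows "inv_state (state \<omega> (Suc t))"
proof -
  let ?s = "state \<omega> t"
  let ?s' = "state \<omega> (Suc t)"
  note b = round_bounds[OF inv run]
  have s': "?s' = perform_round \<omega> (Suc t) ?s" using run by simp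
  have act: "active ?s' = {k\<in>active ?s. ucb ?s' k > (SUP a\<in>active ?s. lcb ?s' a)}"
    unfolding s' by (rule perform_round_active)
  have sub: "active ?s \<subseteq> {1..K}" using inv by (rule inv_stateD)
  have old: "lcb ?s' k = lcb ?s k" "ucb ?s' k = ucb ?s k" if "k \<notin> active ?s" for k
    using that unfolding s' by (simp_all add: perform_round_def)
  have "on_grid (lcb ?s' k) \<and> on_grid (ucb ?s' k) \<and>
        (lcb ?s' k = 0 \<or> lcb ?s' k < Q k q) \<and> Q k q \<le> ucb ?s' k" if "k \<in> {1..K}" for k
    using b[of k] old[of k] inv_stateD(2-5)[OF inv that] by (cases "k \<in> active ?s") auto
  moreover have "\<exists>b\<in>active ?s'. Q k q \<le> lcb ?s' b"
    if k: "k \<in> {1..K}" "k \<notin> active ?s'" and a: "a \<in> active ?s'" for k a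
  proof -
    have a': "a \<in> active ?s" using a act by blast
    have "finite (active ?s)" using sub finite_subset by blast
    then obtain m where m: "m \<in> active ?s" "(SUP a\<in>active ?s. lcb ?s' a) = lcb ?s' m"
      using finite_SUP_attained[of "active ?s" "lcb ?s'"] a' by blast
    have le: "Q k q \<le> lcb ?s' m"
    proof (cases "k \<in> active ?s")
      case True
      then have "ucb ?s' k \<le> lcb ?s' m"
        using k(2) m(2) unfolding act by (simp add: not_less)
      then show ?thesis
        using b(6)[OF True] by (rule order_trans[rotated])
    next
      case False
      then obtain b' where b': "b' \<in> active ?s" "Q k q \<le> lcb ?s b'"
        using inv_stateD(6)[OF inv k(1) False a'] by blast
      have "lcb ?s b' \<le> lcb ?s' b'" by (rule b(3)[OF b'(1)])
      also have "\<dots> \<le> lcb ?s' m"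
        using SUP_upper[OF b'(1), of "lcb ?s'"] m(2) by simp
      finally show ?thesis using b'(2) by (rule order_trans[rotated])
    qed
    show ?thesis
    proof (cases "m \<in> active ?s'")
      case True
      then show ?thesis using le by blast
    next
      case False
      \<comment> \<open>If \<open>m\<close> eliminates itself, its lower bound reaches its own
        quantile, so it is the initial 0, and any surviving arm can replace
        \<open>m\<close>.\<close>
      then have "ucb ?s' m \<le> lcb ?s' m"
        using m unfolding act by (simp add: not_less)
      then have "lcb ?s' m = 0"
        using b(2,6)[OF m(1)] by auto
      then have "lcb ?s' m \<le> lcb ?s' a"
        using on_grid_nonneg[OF b(1)[OF a']] by simp
      then show ?thesis using le a order_trans by blast
    qed
  qed
  moreover have "active ?s' \<subseteq> {1..K}"
    using sub act by blast
  ultimately show ?thesis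
    unfolding inv_state_def by blast
qed

lemma inv: "inv_state (state \<omega> t)"
proof (induction t)
  case 0
  have "on_grid 0" "on_grid (ereal lam)"
    using on_gridI[of 0] on_gridI[of n] by (simp_all add: n_g zero_ereal_def)
  then show ?case
    using arm by (auto simp: inv_state_def)
next
  case (Suc t)
  then show ?case
    using inv_round by (cases "stopping (state \<omega> t)") auto
qed

section \<open>Elimination, stopping and the radii of performed rounds\<close>

lemma active_subset: "active (state \<omega> t) \<subseteq> {1..K}"
  using inv by (rule inv_stateD)

lemma active_Suc_subset: "active (state \<omega> (Suc t)) \<subseteq> active (state \<omega> t)"
  using perform_round_active by (cases "stopping (state \<omega> t)") auto

lemma not_stopping_mono:
  assumes "\<not> stopping (state \<omega> (Suc t))"
  shows "\<not> stopping (state \<omega> t)"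
  using assms by auto

text \<open>The gap supplies an arm \<open>a\<close> with
  \<open>UCB k < Q_k(q + d) + g \<le> Qu_a(q - d) \<le> LCB a + g\<close>. On the grid this means
  \<open>UCB k \<le> LCB a\<close>, so \<open>k\<close> cannot survive.\<close>

lemma eliminated:
  assumes run: "\<not> stopping (state \<omega> t)" and k: "k \<in> {1..K}"
    and gap: "radius (Suc t) < suboptimal_gap K q lam eps c \<nu> k"
  shows "k \<notin> active (state \<omega> (Suc t))"
proof
  let ?s = "state \<omega> t"
  let ?s' = "state \<omega> (Suc t)"
  let ?d = "radius (Suc t)"
  assume ks': "k \<in> active ?s'"
  have act: "active ?s' = {k\<in>active ?s. ucb ?s' k > (SUP a\<in>active ?s. lcb ?s' a)}"
    using run perform_round_active by simp
  have ks: "k \<in> active ?s" using ks' act by blast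
  note b = round_bounds[OF inv run]
  have above: "lcb ?s' a < ucb ?s' k" if "a \<in> active ?s" for a
    using ks' SUP_upper[OF that, of "lcb ?s'"] unfolding act by auto
  obtain a where a: "a \<in> {1..K}" "Q k (q + ?d) + ereal g \<le> Qu a (q - ?d)"
    using less_suboptimal_gapD[OF gap] radius_pos[of "Suc t"] K by auto
  have "0 \<le> lcb ?s' k" using on_grid_nonneg[OF b(1)[OF ks]] .
  \<comment> \<open>Survival gives \<open>0 \<le> LCB k < UCB k\<close>, which excludes the
    alternative \<open>UCB k \<le> 0\<close>.\<close>
  then have "ucb ?s' k < Q k (q + ?d) + ereal g"
    using b(7)[OF ks] above[OF ks] by auto
  then have lt: "ucb ?s' k < Qu a (q - ?d)"
    using a(2) by (rule order_less_le_trans)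
  show False
  proof (cases "a \<in> active ?s")
    case True
    then have "ucb ?s' k < lcb ?s' a + ereal ((real 0 + 1) * g)"
      using lt b(4)[OF True] by simp
    then have "ucb ?s' k \<le> lcb ?s' a"
      using on_grid_gap[OF b(5)[OF ks] b(1)[OF True], of 0]
      by (simp add: zero_ereal_def[symmetric] del: state.simps)
    then show False using above[OF True] by simp
  next
    case False
    \<comment> \<open>If \<open>a\<close> was eliminated earlier, an active arm whose lower bound is
      at least the quantile of \<open>a\<close> replaces it.\<close>
    then obtain m where m: "m \<in> active ?s" "Q a q \<le> lcb ?s m"
      using inv_stateD(6)[OF inv a(1) False ks] by blast
    have "Qu a (q - ?d) \<le> Q a q"
      using radius_pos by (intro upper_quantile_le_quantile) auto
    also have "\<dots> \<le> lcb ?s' m" using m(2) b(3)[OF m(1)] by (rule order_trans)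
    finally show False using lt above[OF m(1)] by auto
  qed
qed

text \<open>Take \<open>S\<close> attaining the gap of \<open>k\<close>. Arms outside
  \<open>S\<close> are eliminated by this round; for each remaining rival \<open>a\<close> the
  losses add up to \<open>UCB a < LCB m + (c + 2) g\<close>, where \<open>m\<close> is
  \<open>k\<close> or its replacement.\<close>

lemma stopped:
  assumes run: "\<not> stopping (state \<omega> t)" and k: "k \<in> eps_optimal K q eps \<nu>"
    and gap: "radius (Suc t) < arm_gap K q lam eps c \<nu> k"
    and nonempty: "active (state \<omega> (Suc t)) \<noteq> {}"
  shows "stopping (state \<omega> (Suc t))"
proof -
  let ?s = "state \<omega> t"
  let ?s' = "state \<omega> (Suc t)"
  let ?d = "radius (Suc t)"
  note b = round_bounds[OF inv run]
  have sub: "active ?s' \<subseteq> active ?s" by (rule active_Suc_subset)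
  have kK: "k \<in> {1..K}" using k eps_optimal_subset by blast
  obtain S where S: "S \<subseteq> {1..K}" "?d < gap_within K q lam eps c \<nu> S k"
    using arm_gap_eps_optimal[OF k] gap by metis
  note gw = less_gap_withinD[OF S(2) less_imp_le[OF radius_pos]]
  have actS: "active ?s' \<subseteq> S"
    using eliminated[OF run] gw(1) active_subset[of "Suc t"] by blast
  \<comment> \<open>The condition on \<open>S - {k}\<close> covers both uses: \<open>m = k\<close>,
    or \<open>k\<close> is no longer active.\<close>
  have stop: "stopping ?s'"
    if m: "m \<in> active ?s'" and dom: "active ?s' - {m} \<subseteq> S - {k}"
      and le: "Qu k (q - ?d) \<le> lcb ?s' m + ereal g" for m
  proof -
    have mlcb: "on_grid (lcb ?s' m)" using b(1) m sub by blast
    have "ucb ?s' a \<le> lcb ?s' m + ereal ((real c + 1) * g)" if a: "a \<in> active ?s' - {m}" for a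
    proof -
      have as: "a \<in> active ?s" using a sub by blast
      have "ucb ?s' a \<le> lcb ?s' m + ereal (real (c + 1) * g)"
      proof (cases "ucb ?s' a \<le> 0")
        case True
        also have "0 \<le> lcb ?s' m + ereal (real (c + 1) * g)"
          using on_grid_nonneg[OF mlcb] g_pos by simp
        finally show ?thesis .
      next
        case False
        then have "ucb ?s' a < Q a (q + ?d) + ereal g" using b(7)[OF as] by blast
        also have "\<dots> \<le> Qu k (q - ?d) + ereal (real c * g) + ereal g"
          using gw(2) a dom by (intro add_right_mono) blast
        also have "\<dots> \<le> lcb ?s' m + ereal g + ereal (real c * g) + ereal g"
          by (intro add_right_mono le)
        also have "\<dots> = lcb ?s' m + ereal ((real (c + 1) + 1) * g)"
          by (cases "lcb ?s' m") (auto simp del: state.simps simp: algebra_simps)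
        \<comment> \<open>Strictness lowers \<open>c + 2\<close> steps to \<open>c + 1\<close>, the
          tolerance of the stopping rule.\<close>
        finally show ?thesis by (rule on_grid_gap[OF b(5)[OF as] mlcb])
      qed
      then show ?thesis by (simp add: add.commute)
    qed
    then have "(SUP a\<in>active ?s' - {m}. ucb ?s' a) \<le> lcb ?s' m + ereal ((real c + 1) * g)"
      by (intro SUP_least)
    then show ?thesis
      unfolding stopping_def using m by (auto simp: ereal_minus_le intro!: bexI[of _ m])
  qed
  show ?thesis
  proof (cases "k \<in> active ?s'")
    case True
    then show ?thesis using stop[of k] b(4)[of k] sub actS by blast
  next
    case False
    then obtain m where m: "m \<in> active ?s'" "Q k q \<le> lcb ?s' m"
      using inv_stateD(6)[OF inv kK False] nonempty by blast
    have "Qu k (q - ?d) \<le> Q k q"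
      using radius_pos by (intro upper_quantile_le_quantile) auto
    also have "\<dots> \<le> lcb ?s' m" by fact
    also have "\<dots> \<le> lcb ?s' m + ereal g" using g_pos by (intro add_increasing2) auto
    finally show ?thesis using stop[OF m(1)] actS False by blast
  qed
qed

definition max_gap :: "nat \<Rightarrow> real" where
  "max_gap k = max (arm_gap K q lam eps c \<nu> k)
                   (Max (arm_gap K q lam eps c \<nu> ` eps_optimal K q eps \<nu>))"

lemma max_gap_bounds:
  assumes "k \<in> {1..K}"
  shows "max_gap k \<in> {0..min q (1 - q)}"
proof -
  obtain a where "a \<in> eps_optimal K q eps \<nu>"
    "Max (arm_gap K q lam eps c \<nu> ` eps_optimal K q eps \<nu>) = arm_gap K q lam eps c \<nu> a"
    using Max_arm_gap_attained[of K eps q \<nu> lam c] K eps by auto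
  moreover from this have "a \<in> {1..K}" using eps_optimal_subset by blast
  ultimately show ?thesis
    using arm_gap_bounds[OF q \<nu> K, of a eps c] arm_gap_bounds[OF q \<nu> K, of k eps c] assms
    by (auto simp: max_gap_def)
qed

text \<open>The preceding round neither eliminated \<open>k\<close> nor led to stopping, so the
  relevant gaps are at most its radius, which is twice the present one.\<close>

lemma max_gap_le_radius:
  assumes run: "\<not> stopping (state \<omega> t)" and k: "k \<in> active (state \<omega> t)"
  shows "max_gap k \<le> 2 * radius (Suc t)"
proof (cases t)
  case 0
  \<comment> \<open>The first round has no predecessor, but its radius \<open>min q (1 - q)\<close>
    bounds all gaps.\<close>
  then show ?thesis
    using max_gap_bounds[of k] k q by (auto simp: radius_Suc min_def)
next
  case (Suc r)
  have kK: "k \<in> {1..K}" using k active_subset by blast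
  have run': "\<not> stopping (state \<omega> r)"
    using not_stopping_mono run Suc by blast
  \<comment> \<open>The active arm \<open>k\<close> shows that the active set is nonempty, as
    \<open>stopped\<close> requires.\<close>
  have opt: "arm_gap K q lam eps c \<nu> a \<le> radius t" if "a \<in> eps_optimal K q eps \<nu>" for a
    using stopped[OF run' that] run k Suc by (auto simp: not_less[symmetric])
  obtain a where a: "a \<in> eps_optimal K q eps \<nu>"
    "Max (arm_gap K q lam eps c \<nu> ` eps_optimal K q eps \<nu>) = arm_gap K q lam eps c \<nu> a"
    using Max_arm_gap_attained[of K eps q \<nu> lam c] K eps by auto
  have "arm_gap K q lam eps c \<nu> k \<le> radius t"
  proof (cases "k \<in> eps_optimal K q eps \<nu>")
    case True
    then show ?thesis by (rule opt)
  next
    case False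
    then show ?thesis
      using eliminated[OF run' kK] k Suc by (auto simp: arm_gap_def not_less[symmetric])
  qed
  then show ?thesis
    using opt[OF a(1)] a(2) by (simp add: max_gap_def radius_halved)
qed

section \<open>Counting the pulls\<close>

text \<open>With \<open>x = c * lam / eps \<ge> 1\<close>, the product
  \<open>(c + 1) * lam / eps\<close> is at most \<open>2 x\<close>; the ceiling and the three extra
  points add at most \<open>4 \<le> 4 x\<close>.\<close>

lemma grid_points_le: "real (n + 3) \<le> 6 * (real c * lam / eps)"
proof -
  have "1 * 1 \<le> real c * (lam / eps)"
    using c eps by (intro mult_mono) auto
  moreover have "lam / eps \<le> real c * (lam / eps)"
    using mult_right_mono[of 1 "real c" "lam / eps"] c eps by simp
  moreover have "(real c + 1) * lam / eps = real c * (lam / eps) + lam / eps"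
    by (simp add: distrib_right add_divide_distrib)
  ultimately show ?thesis using n_le by simp
qed

text \<open>This bounds the logarithm in the pull cap independently of the round. The factor 24 is 6
  from the grid points, 2 from the confidence parameter and 2 from
  \<open>max_gap k / 2 \<le> radius\<close>.\<close>

definition log_term :: "nat \<Rightarrow> real" where
  "log_term k = ln (24 * (real c * lam * real K / eps) / (\<delta> * max_gap k))"

text \<open>The radius is replaced by the gap only inside the logarithm; the factor
  \<open>1 / radius^2\<close> is kept for the geometric sum. The 4 comes from the half-width
  \<open>radius / 2\<close>.\<close>

lemma call_pulls_le:
  assumes run: "\<not> stopping (state \<omega> t)" and k: "k \<in> active (state \<omega> t)" and pos: "0 < max_gap k"
  shows "real (tree_pulls (call_tree \<omega> (Suc t) (state \<omega> t) k b) r)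
           \<le> 4 * C0 * log_term k / (radius (Suc t))\<^sup>2"
proof -
  let ?d = "radius (Suc t)"
  let ?A = "active (state \<omega> t)"
  have d: "0 < ?d" "max_gap k \<le> 2 * ?d"
    using radius_pos max_gap_le_radius[OF run k] by auto
  have "finite ?A" using active_subset finite_subset by blast
  with k have card: "0 < card ?A" by (auto simp: card_gt_0_iff)
  have cardK: "card ?A \<le> K" using card_mono[OF _ active_subset, of t] by simp
  have "real (n + 3) / (\<delta> * ?d / (2 * real (card ?A)))
      = (real (n + 3) * (2 * real (card ?A))) / (\<delta> * ?d)"
    by simp
  also have "\<dots> \<le> (6 * (real c * lam / eps) * (2 * real K)) / (\<delta> * (max_gap k / 2))"
    using grid_points_le cardK d pos \<delta> eps
    by (intro frac_le mult_mono mult_nonneg_nonneg) auto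
  also have "\<dots> = 24 * (real c * lam * real K / eps) / (\<delta> * max_gap k)"
    by (simp add: field_simps)
  finally have "ln (real (n + 3) / (\<delta> * ?d / (2 * real (card ?A)))) \<le> log_term k"
    unfolding log_term_def using d \<delta> card by (intro ln_mono) auto
  then have "C0 / (?d / 2)\<^sup>2 * ln (real (n + 3) / (\<delta> * ?d / (2 * real (card ?A))))
      \<le> C0 / (?d / 2)\<^sup>2 * log_term k"
    using C0 by (intro mult_left_mono) auto
  also have "\<dots> = 4 * C0 * log_term k / ?d\<^sup>2"
    by (simp add: power_divide)
  finally show ?thesis
    using quant_est_call(1)[OF k active_subset, of t b r] by linarith
qed

text \<open>
  The cost of a round quadruples from one round to the next, so the pulls of all rounds amount to
  at most 4/3 of those of the last one; hence the factor 32/3.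
\<close>

lemma pulls_le:
  assumes pos: "0 < max_gap k" and log: "0 \<le> log_term k"
  shows "real (pulls (state \<omega> t) k)
           \<le> 32 / 3 * C0 * log_term k / (max (radius t) (max_gap k / 2))\<^sup>2"
proof (induction t)
  case 0
  then show ?case using C0 log by simp
next
  case (Suc t)
  let ?X = "32 / 3 * C0 * log_term k"
  let ?s = "state \<omega> t"
  let ?d = "radius (Suc t)"
  have X: "0 \<le> ?X" using C0 log by simp
  have d: "0 < ?d" "radius t = 2 * ?d"
    using radius_pos radius_halved[of t] by auto
  show ?case
  proof (cases "\<not> stopping ?s \<and> k \<in> active ?s")
    case True
    \<comment> \<open>While \<open>k\<close> is pulled, the radius still dominates the maximum in
      the bound; later the maximum freezes at \<open>max_gap k / 2\<close>.\<close>
    have "max_gap k \<le> 2 * ?d" using True max_gap_le_radius by blast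
    then have max: "max ?d (max_gap k / 2) = ?d" "max (radius t) (max_gap k / 2) = 2 * ?d"
      using d by auto
    have "real (pulls (state \<omega> (Suc t)) k)
        = real (pulls ?s k) + real (l_pulls \<omega> (Suc t) ?s k) + real (u_pulls \<omega> (Suc t) ?s k)"
      using True by (simp add: perform_round_def)
    also have "\<dots> \<le> ?X / (2 * ?d)\<^sup>2 + 4 * C0 * log_term k / ?d\<^sup>2 + 4 * C0 * log_term k / ?d\<^sup>2"
      using Suc True pos call_pulls_le unfolding max l_pulls_def u_pulls_def
      by (intro add_mono) auto
    also have "\<dots> = ?X / ?d\<^sup>2"
      using d by (simp add: field_simps power2_eq_square)
    finally show ?thesis by (simp only: max)
  next
    case False
    then have "pulls (state \<omega> (Suc t)) k = pulls ?s k"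
      by (auto simp: perform_round_def)
    also have "real (pulls ?s k) \<le> ?X / (max (radius t) (max_gap k / 2))\<^sup>2" by (rule Suc)
    also have "\<dots> \<le> ?X / (max ?d (max_gap k / 2))\<^sup>2"
      using X d by (intro divide_left_mono power_mono mult_pos_pos zero_less_power) auto
    finally show ?thesis .
  qed
qed

text \<open>The argument of the last logarithm in \<open>R\<close> is at least 2, since
  \<open>2 \<le> K\<close>. Hence \<open>ln 24 \<le> ln 32 = 5 ln 2\<close> is absorbed by five
  copies of that logarithm, the other summands being nonnegative.\<close>

lemma log_term_le:
  assumes "k \<in> {1..K}" and pos: "0 < max_gap k"
  defines "R \<equiv> ln (1 / \<delta>) + ln (1 / max_gap k) + ln (real c * lam * real K / eps)"
  shows "0 \<le> log_term k" "log_term k \<le> 6 * R"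
proof -
  let ?Z = "real c * lam * real K / eps"
  have "1 * 1 * 2 \<le> real c * (lam / eps) * real K"
    using c eps K by (intro mult_mono) auto
  then have Z: "2 \<le> ?Z" by (simp add: field_simps)
  have m: "max_gap k \<le> 1"
    using max_gap_bounds[OF assms(1)] q by auto
  have nonneg: "0 \<le> ln (1 / \<delta>)" "0 \<le> ln (1 / max_gap k)"
    using \<delta> pos m by auto
  have lnZ: "ln 2 \<le> ln ?Z" "0 \<le> ln ?Z" using Z by (auto intro: ln_mono)
  have "ln (24::real) \<le> ln (2 ^ 5)" by (intro ln_mono) auto
  also have "\<dots> = 5 * ln 2" by (simp only: ln_realpow of_nat_numeral)
  finally have ln24: "ln (24::real) \<le> 5 * ln ?Z" using lnZ by linarith
  have eq: "log_term k = ln 24 + R"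
  proof -
    have ln3: "ln (24 * z * x * y) = ln 24 + ln z + ln x + ln y"
      if "0 < x" "0 < y" "0 < z" for x y z :: real
      using that by (simp add: ln_mult_pos)
    have "log_term k = ln (24 * ?Z * (1 / \<delta>) * (1 / max_gap k))"
      unfolding log_term_def by (simp add: divide_inverse mult_ac)
    also have "\<dots> = ln 24 + ln ?Z + ln (1 / \<delta>) + ln (1 / max_gap k)"
      using Z \<delta> pos by (intro ln3) auto
    finally show ?thesis by (simp add: R_def)
  qed
  show "0 \<le> log_term k" "log_term k \<le> 6 * R"
    using eq ln24 lnZ nonneg by (auto simp: R_def)
qed

lemma total_pulls_le:
  assumes pos: "\<And>k. k \<in> {1..K} \<Longrightarrow> 0 < max_gap k"
  shows "total_pulls \<omega> \<le> ereal (256 * C0 * (\<Sum>k\<in>{1..K}. 1 / (max_gap k)\<^sup>2 *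
           (ln (1 / \<delta>) + ln (1 / max_gap k) + ln (real c * lam * real K / eps))))"
  unfolding total_pulls_def
proof (intro SUP_least)
  fix t
  let ?R = "\<lambda>k. ln (1 / \<delta>) + ln (1 / max_gap k) + ln (real c * lam * real K / eps)"
  have "real (pulls (state \<omega> t) k) \<le> 256 * C0 * (1 / (max_gap k)\<^sup>2 * ?R k)"
    if k: "k \<in> {1..K}" for k
  proof -
    note m = pos[OF k]
    note log = log_term_le[OF k m]
    have "real (pulls (state \<omega> t) k)
        \<le> 32 / 3 * C0 * log_term k / (max (radius t) (max_gap k / 2))\<^sup>2"
      using pulls_le[OF m log(1)] .
    \<comment> \<open>The final constant is \<open>256 = 32/3 * 6 * 4\<close>, the 4 stemming from
      the halved gap.\<close>
    also have "\<dots> \<le> 32 / 3 * C0 * (6 * ?R k) / (max_gap k / 2)\<^sup>2"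
      using m log C0 by (intro frac_le mult_left_mono power_mono mult_nonneg_nonneg) auto
    also have "\<dots> = 256 * C0 * (1 / (max_gap k)\<^sup>2 * ?R k)"
      using m by (simp add: field_simps power2_eq_square)
    finally show ?thesis .
  qed
  then have "(\<Sum>k\<in>{1..K}. real (pulls (state \<omega> t) k))
      \<le> (\<Sum>k\<in>{1..K}. 256 * C0 * (1 / (max_gap k)\<^sup>2 * ?R k))"
    by (rule sum_mono)
  then show "ereal (real (\<Sum>k\<in>{1..K}. pulls (state \<omega> t) k))
      \<le> ereal (256 * C0 * (\<Sum>k\<in>{1..K}. 1 / (max_gap k)\<^sup>2 * ?R k))"
    by (simp add: sum_distrib_left)
qed

end

theorem theorem14:
  fixes C0 :: real
  assumes "C0 > 0"
  shows "\<exists>C>0. \<forall>(QE :: quant_est) (K :: nat) (lam :: real) (eps :: real) (q :: real) (\<delta> :: real)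
           (c :: nat) (\<nu> :: nat \<Rightarrow> real measure).
           quant_est_spec C0 QE \<longrightarrow> 2 \<le> K \<longrightarrow> 0 < q \<and> q < 1 \<longrightarrow> 0 < eps \<and> eps < lam \<longrightarrow>
           0 < \<delta> \<and> \<delta> < 1 \<longrightarrow> 1 \<le> c \<longrightarrow> \<nu> \<in> instances K q lam \<longrightarrow>
           (\<forall>\<omega> \<in> algorithm1.good_event QE K lam eps q \<delta> c \<nu>.
              algorithm1.total_pulls QE K lam eps q \<delta> c \<omega> \<le>
              (let \<Delta> = Max (arm_gap K q lam eps c \<nu> ` eps_optimal K q eps \<nu>);
                   m = (\<lambda>k. max (arm_gap K q lam eps c \<nu> k) \<Delta>)
               in if \<exists>k\<in>{1..K}. m k = 0 then \<infinity>
                  else ereal (C * (\<Sum>k\<in>{1..K}. 1 / (m k)\<^sup>2 *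
                         (ln (1 / \<delta>) + ln (1 / m k) + ln (real c * lam * real K / eps))))))"
proof (intro exI[of _ "256 * C0"] conjI allI impI ballI)
  show "0 < 256 * C0" using assms by simp
next
  fix QE :: quant_est and K :: nat and lam eps q \<delta> :: real and c :: nat
    and \<nu> :: "nat \<Rightarrow> real measure" and \<omega> :: sample
  assume "quant_est_spec C0 QE" "2 \<le> K" "0 < q \<and> q < 1" "0 < eps \<and> eps < lam" "0 < \<delta> \<and> \<delta> < 1"
    "1 \<le> c" "\<nu> \<in> instances K q lam" "\<omega> \<in> algorithm1.good_event QE K lam eps q \<delta> c \<nu>"
  then interpret algorithm1_run QE K lam eps q \<delta> c C0 \<nu> \<omega>
    using assms by unfold_locales auto
  show "total_pulls \<omega> \<le>
              (let \<Delta> = Max (arm_gap K q lam eps c \<nu> ` eps_optimal K q eps \<nu>);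
                   m = (\<lambda>k. max (arm_gap K q lam eps c \<nu> k) \<Delta>)
               in if \<exists>k\<in>{1..K}. m k = 0 then \<infinity>
                  else ereal (256 * C0 * (\<Sum>k\<in>{1..K}. 1 / (m k)\<^sup>2 *
                         (ln (1 / \<delta>) + ln (1 / m k) + ln (real c * lam * real K / eps)))))"
  proof (cases "\<exists>k\<in>{1..K}. max_gap k = 0")
    case True
    then show ?thesis by (simp add: Let_def max_gap_def)
  next
    case False
    \<comment> \<open>Gaps are nonnegative, so a nonzero one is positive.\<close>
    then have "0 < max_gap k" if "k \<in> {1..K}" for k
      using max_gap_bounds[OF that] that by force
    then have "total_pulls \<omega> \<le> ereal (256 * C0 * (\<Sum>k\<in>{1..K}. 1 / (max_gap k)\<^sup>2 *
           (ln (1 / \<delta>) + ln (1 / max_gap k) + ln (real c * lam * real K / eps))))"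
      by (rule total_pulls_le)
    then show ?thesis
      using False by (simp only: Let_def max_gap_def if_False)
  qed
qed

end
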